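(* Let $G$ be a linear group (i.e. a group isomorphic to a subgroup of $GL_n(F)$ for some field $F$ and some integer $n\geq 1$) and let $H\leq G$ be a subgroup. Then the chain $(E_k(H))_{k\in\mathbb{N}}$ stabilizes in $G$, i.e. there is $n_0\in\mathbb{N}$ such that $E_m(H)=E_{n_0}(H)$ for all $m\geq n_0$.
   Context: Commutators are $[g,h]=g^{-1}h^{-1}gh$, and for an element $g$ and a subset $S$ of a group, $[g,S]=\{[g,s]\mid s\in S\}$. Iterated centralizers: for a group $G$ and a subset $A\subseteq G$, set $C_G^0(A)=1$ and for $k\geq 1$ $$C_G^k(A)=\Big\{x\in\bigcap_{n<k}N_G\big(C_G^n(A)\big)\;\Big|\;[x,A]\subseteq C_G^{k-1}(A)\Big\},$$ where $N_G$ denotes the normalizer in $G$. These are subgroups of $G$. Envelopes: for a group $G$ and a subgroup $H\leq G$, set $E_0(H)=G$ and for $k\geq 0$ $$E_{k+1}(H)=\Big\{g\in E_k(H)\;\Big|\;\big[g,C_{E_k(H)}^{k+1}(H)\big]\subseteq C_{E_k(H)}^{k}(H)\Big\},$$ where the iterated centralizers are computed in the group $E_k(H)$. These form a descending chain of subgroups $G=E_0(H)\geq E_1(H)\geq\cdots\geq H$. *)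

theory Defs
  imports "HOL-Algebra.Group_Action" "Jordan_Normal_Form.Matrix"
begin

definition general_linear_group :: "'f::field itself \<Rightarrow> nat \<Rightarrow> 'f mat monoid"
  where "general_linear_group F n = units_of (ring_mat F n ())"

text \<open>The field is the type \<^emph>\<open>'f\<close>, so it is existentially quantified only at the level of types:
  a theorem assuming \<^emph>\<open>linear_group TYPE('f) G\<close> for a free \<^emph>\<open>'f\<close> covers all fields.\<close>

definition linear_group :: "'f::field itself \<Rightarrow> ('g, 'm) monoid_scheme \<Rightarrow> bool"
  where "linear_group F G \<longleftrightarrow> group G \<and>
    (\<exists>n\<ge>1. \<exists>K. subgroup K (general_linear_group F n) \<and>
       G \<cong> (general_linear_group F n)\<lparr>carrier := K\<rparr>)"

definition commutator :: "('g, 'm) monoid_scheme \<Rightarrow> 'g \<Rightarrow> 'g \<Rightarrow> 'g"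
  where "commutator G g h = inv\<^bsub>G\<^esub> g \<otimes>\<^bsub>G\<^esub> inv\<^bsub>G\<^esub> h \<otimes>\<^bsub>G\<^esub> g \<otimes>\<^bsub>G\<^esub> h"

definition commutator_set :: "('g, 'm) monoid_scheme \<Rightarrow> 'g \<Rightarrow> 'g set \<Rightarrow> 'g set"
  where "commutator_set G g S = {commutator G g s | s. s \<in> S}"

context
  notes image_cong [fundef_cong]
begin

fun iterated_centralizer :: "('g, 'm) monoid_scheme \<Rightarrow> 'g set \<Rightarrow> nat \<Rightarrow> 'g set"
  where
    "iterated_centralizer G A 0 = {\<one>\<^bsub>G\<^esub>}"
  | "iterated_centralizer G A (Suc k) =
       {x \<in> (\<Inter>n\<in>{..<Suc k}. normalizer G (iterated_centralizer G A n)).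
          commutator_set G x A \<subseteq> iterated_centralizer G A k}"

end

fun envelope :: "('g, 'm) monoid_scheme \<Rightarrow> 'g set \<Rightarrow> nat \<Rightarrow> 'g set"
  where
    "envelope G H 0 = carrier G"
  | "envelope G H (Suc k) =
       (let E = G\<lparr>carrier := envelope G H k\<rparr>
        in {g \<in> carrier E.
              commutator_set E g (iterated_centralizer E H (Suc k)) \<subseteq> iterated_centralizer E H k})"

end

theory Submission
  imports Defs "HOL-Library.Function_Algebras" "HOL-Computational_Algebra.Polynomial"
begin

text \<open>
  The envelopes of \<open>H\<close> are closed in the Zariski topology of the linear group \<open>G\<close>, and this
  topology is Noetherian; a descending chain of closed sets therefore stabilizes.

  Closedness rests on one group-theoretic observation. Write \<open>E\<close> for the \<open>k\<close>-th envelope and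
  \<open>C\<^sub>j\<close> for the \<open>j\<close>-th iterated centralizer of \<open>H\<close> in \<open>E\<close>. Then \<open>C\<^sub>0 \<subseteq> \<dots> \<subseteq> C\<^sub>k\<close> are normal subgroups
  of \<open>E\<close>, so that the normalizer conditions in the definition of \<open>C\<^sub>0, \<dots>, C\<^bsub>k+1\<^esub>\<close> are void and
  \<open>C\<^bsub>k+1\<^esub>\<close> is the preimage in \<open>E\<close> of the centralizer of the image of \<open>H\<close> in \<open>E/C\<^sub>k\<close>. The next envelope
  \<open>E'\<close> is the preimage of the centralizer of \<open>C\<^bsub>k+1\<^esub>/C\<^sub>k\<close>, hence of a double centralizer. It contains
  \<open>H\<close> and \<open>C\<^sub>k\<close>, so passing from \<open>E\<close> to \<open>E'\<close> does not change \<open>C\<^sub>0, \<dots>, C\<^sub>k\<close>, while the new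
  \<open>(k+1)\<close>-st centralizer \<open>E' \<inter> C\<^bsub>k+1\<^esub>\<close> is central in \<open>E'\<close> modulo \<open>C\<^sub>k\<close> and therefore normal; the
  description propagates to all \<open>k\<close> (\<open>envelope_normality_step\<close>). Thus all these sets arise from
  \<open>G\<close> and the trivial subgroup by the operation \<open>S, A, N \<mapsto> {x \<in> S. [x,A] \<subseteq> N}\<close>
  (\<open>envelope_induct\<close>). As \<open>x \<mapsto> [x,a]\<close> is a polynomial map in the entries of the matrices of \<open>x\<close>
  and its inverse, this operation preserves closed sets.

  For the Noetherian property, let \<open>R\<close> be the ring of functions on \<open>G\<close> generated by the constants
  and the entries of the matrices of \<open>x\<close> and \<open>x\<^sup>-\<^sup>1\<close>. It is reached from the field of constants by
  adjoining finitely many functions, one at a time, and \<open>R[f]\<close> is a homomorphic image of a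
  polynomial ring in one variable over \<open>R\<close>. The Hilbert basis theorem in one variable thus
  suffices, provided that it is stated for a subring \<open>R\<close> of a ring type: every stage is then a
  subring of one and the same type of functions, and the induction does not leave this type.
\<close>

section \<open>Noetherian subrings and the Hilbert basis theorem\<close>

definition unital_subring :: "'a::comm_ring_1 set \<Rightarrow> bool"
  where "unital_subring R \<longleftrightarrow> 1 \<in> R \<and> (\<forall>x\<in>R. \<forall>y\<in>R. x - y \<in> R \<and> x * y \<in> R)"

text \<open>For a subring \<open>R\<close> of the ambient type, the scalars of a linear combination must be taken from
\<open>R\<close>; an ideal of the whole type would be too large.\<close>

inductive_set ideal_span :: "'a::comm_ring_1 set \<Rightarrow> 'a set \<Rightarrow> 'a set" for R T
  where
    zero: "0 \<in> ideal_span R T"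
  | step: "r \<in> R \<Longrightarrow> t \<in> T \<Longrightarrow> x \<in> ideal_span R T \<Longrightarrow> r * t + x \<in> ideal_span R T"

text \<open>Each sequence has a term generated by the earlier ones. This is the ascending chain
condition for ideals, in a form that transfers to homomorphic images by lifting the sequence term
by term, and that contradicts a strictly descending chain of zero sets when applied to a sequence
of functions that separate its successive members.\<close>

definition noetherian_subring :: "'a::comm_ring_1 set \<Rightarrow> bool"
  where "noetherian_subring R \<longleftrightarrow> unital_subring R \<and>
    (\<forall>a :: nat \<Rightarrow> 'a. range a \<subseteq> R \<longrightarrow> (\<exists>n. a n \<in> ideal_span R (a ` {..<n})))"

lemma unital_subring_closed:
  assumes "unital_subring R"
  shows "0 \<in> R" "1 \<in> R"
    and "x \<in> R \<Longrightarrow> y \<in> R \<Longrightarrow> x - y \<in> R"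
    and "x \<in> R \<Longrightarrow> - x \<in> R"
    and "x \<in> R \<Longrightarrow> y \<in> R \<Longrightarrow> x + y \<in> R"
    and "x \<in> R \<Longrightarrow> y \<in> R \<Longrightarrow> x * y \<in> R"
proof -
  have diff: "x - y \<in> R" if "x \<in> R" "y \<in> R" for x y
    using assms that unfolding unital_subring_def by blast
  show one: "1 \<in> R" and "x \<in> R \<Longrightarrow> y \<in> R \<Longrightarrow> x * y \<in> R"
    using assms unfolding unital_subring_def by blast+
  show zero: "0 \<in> R"
    using diff[OF one one] by simp
  have minus: "- x \<in> R" if "x \<in> R" for x
    using diff[OF zero that] by simp
  show "x \<in> R \<Longrightarrow> y \<in> R \<Longrightarrow> x - y \<in> R" "x \<in> R \<Longrightarrow> - x \<in> R"
    by (fact diff minus)+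
  show "x \<in> R \<Longrightarrow> y \<in> R \<Longrightarrow> x + y \<in> R"
    using diff[of x "- y"] minus[of y] by simp
qed

lemma unital_subring_sum:
  assumes "unital_subring R" and "\<And>i. i \<in> I \<Longrightarrow> f i \<in> R"
  shows "sum f I \<in> R"
  using assms(2)
  by (induction I rule: infinite_finite_induct) (auto intro: unital_subring_closed[OF assms(1)])

lemma unital_subring_power:
  assumes "unital_subring R" and "x \<in> R"
  shows "x ^ n \<in> R"
  by (induction n) (auto intro: unital_subring_closed[OF assms(1)] assms(2))

lemma ideal_span_add:
  assumes "x \<in> ideal_span R T" and "y \<in> ideal_span R T"
  shows "x + y \<in> ideal_span R T"
  using assms by induction (auto simp: add.assoc intro: ideal_span.step)

lemma ideal_span_mult:
  assumes "unital_subring R" and "r \<in> R" and "x \<in> ideal_span R T"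
  shows "r * x \<in> ideal_span R T"
  using assms(3)
proof induction
  case (step s t x)
  have "r * (s * t + x) = (r * s) * t + r * x"
    by (simp add: algebra_simps)
  with step show ?case
    by (auto intro: ideal_span.step unital_subring_closed[OF assms(1)] assms(2))
qed (simp add: ideal_span.zero)

lemma ideal_span_diff:
  assumes "unital_subring R" and "x \<in> ideal_span R T" and "y \<in> ideal_span R T"
  shows "x - y \<in> ideal_span R T"
proof -
  have "- 1 \<in> R"
    using unital_subring_closed[OF assms(1)] by blast
  from ideal_span_add[OF assms(2) ideal_span_mult[OF assms(1) this assms(3)]]
  show ?thesis by simp
qed

lemma ideal_span_generator:
  assumes "unital_subring R" and "t \<in> T"
  shows "t \<in> ideal_span R T"
  using ideal_span.step[OF unital_subring_closed(2)[OF assms(1)] assms(2) ideal_span.zero] by simp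

lemma ideal_span_least:
  assumes "unital_subring R" and "T \<subseteq> ideal_span R U"
  shows "ideal_span R T \<subseteq> ideal_span R U"
proof
  fix x assume "x \<in> ideal_span R T"
  then show "x \<in> ideal_span R U"
    by induction
      (use assms in \<open>auto intro: ideal_span.zero ideal_span_add ideal_span_mult\<close>)
qed

lemma ideal_span_mono:
  assumes "T \<subseteq> U"
  shows "ideal_span R T \<subseteq> ideal_span R U"
proof
  fix x assume "x \<in> ideal_span R T"
  then show "x \<in> ideal_span R U"
    by induction (use assms in \<open>auto intro: ideal_span.intros\<close>)
qed

definition polys_over :: "'a::comm_ring_1 set \<Rightarrow> 'a poly set"
  where "polys_over R = {p. \<forall>i. coeff p i \<in> R}"

lemma unital_subring_polys_over:
  assumes "unital_subring R"
  shows "unital_subring (polys_over R)"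
  unfolding unital_subring_def polys_over_def
  by (auto simp: coeff_mult coeff_1 intro!: unital_subring_closed[OF assms] unital_subring_sum[OF assms])

lemma monom_in_polys_over:
  assumes "unital_subring R" and "r \<in> R"
  shows "monom r d \<in> polys_over R"
  using assms unital_subring_closed(1)[OF assms(1)] by (auto simp: polys_over_def)

text \<open>A linear combination of leading coefficients is realised as the coefficient of degree \<open>d\<close> of a
combination of the polynomials themselves, by shifting each of them up to degree \<open>d\<close>. It
is stated as a coefficient rather than a leading coefficient because the combination may be zero.\<close>

lemma lift_leading_coefficient:
  assumes R: "unital_subring R"
    and deg: "\<And>p. p \<in> S \<Longrightarrow> degree p \<le> d"
    and x: "x \<in> ideal_span R (lead_coeff ` S)"
  shows "\<exists>q \<in> ideal_span (polys_over R) S. degree q \<le> d \<and> coeff q d = x"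
  using x
proof induction
  case zero
  show ?case
    by (rule bexI[of _ 0]) (auto intro: ideal_span.zero)
next
  case (step r t x)
  then obtain q p where q: "q \<in> ideal_span (polys_over R) S" "degree q \<le> d" "coeff q d = x"
    and p: "p \<in> S" "t = lead_coeff p" by auto
  let ?m = "monom r (d - degree p) * p"
  have "degree ?m \<le> d"
    using degree_mult_le[of "monom r (d - degree p)" p] degree_monom_le[of r "d - degree p"]
      deg[OF p(1)] by linarith
  moreover have "coeff ?m d = r * t"
    using deg[OF p(1)] p(2) by (simp add: coeff_monom_mult)
  ultimately show ?case
    using q p(1) monom_in_polys_over[OF R step.hyps(1)]
    by (intro bexI[of _ "?m + q"]) (auto intro: ideal_span.step degree_add_le)
qed

text \<open>The classical argument by minimal degrees. Let \<open>J\<close> be the union of the ideals generated by initial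
segments of a sequence no term of which is generated by its predecessors; no finite subset generates
\<open>J\<close>. Choose \<open>p\<^sub>0, p\<^sub>1, \<dots>\<close> in \<open>J\<close>, each of least degree outside the ideal of its predecessors. Some
leading coefficient is a combination of the earlier ones, and subtracting the corresponding
combination of polynomials gives an element that is still outside the ideal, yet zero or of smaller
degree.\<close>

theorem Hilbert_basis:
  assumes "noetherian_subring R"
  shows "noetherian_subring (polys_over R)"
proof -
  have R: "unital_subring R"
    using assms noetherian_subring_def by blast
  let ?P = "polys_over R"
  have P: "unital_subring ?P"
    by (rule unital_subring_polys_over[OF R])
  have "\<exists>n. a n \<in> ideal_span ?P (a ` {..<n})" if a: "range a \<subseteq> ?P" for a :: "nat \<Rightarrow> 'a poly"
  proof (rule ccontr)
    assume "\<not> ?thesis"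
    then have new: "a n \<notin> ideal_span ?P (a ` {..<n})" for n
      by blast
    define J where "J = (\<Union>n. ideal_span ?P (a ` {..<n}))"
    have mono: "ideal_span ?P (a ` {..<m}) \<subseteq> ideal_span ?P (a ` {..<n})" if "m \<le> n" for m n
      using that by (intro ideal_span_mono) auto
    have JP: "x \<in> ?P" if "x \<in> J" for x
    proof -
      have "x \<in> ideal_span ?P (a ` {..<n}) \<Longrightarrow> x \<in> ?P" for n
        by (induction rule: ideal_span.induct)
          (use a in \<open>auto intro!: unital_subring_closed[OF P]\<close>)
      with that show ?thesis
        unfolding J_def by blast
    qed
    have Jdiff: "x - y \<in> J" if xy: "x \<in> J" "y \<in> J" for x y
    proof -
      from xy obtain m n where "x \<in> ideal_span ?P (a ` {..<m})" "y \<in> ideal_span ?P (a ` {..<n})"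
        unfolding J_def by blast
      then have "x - y \<in> ideal_span ?P (a ` {..<max m n})"
        using mono[of m "max m n"] mono[of n "max m n"] by (intro ideal_span_diff[OF P]) auto
      then show ?thesis
        unfolding J_def by blast
    qed
    have bounded: "\<exists>m. T \<subseteq> ideal_span ?P (a ` {..<m})" if "finite T" "T \<subseteq> J" for T
      using that
    proof (induction T)
      case (insert x T)
      then obtain m n where "T \<subseteq> ideal_span ?P (a ` {..<m})" "x \<in> ideal_span ?P (a ` {..<n})"
        unfolding J_def by blast
      then have "insert x T \<subseteq> ideal_span ?P (a ` {..<max m n})"
        using mono[of m "max m n"] mono[of n "max m n"] by auto
      then show ?case by blast
    qed simp
    \<comment> \<open>A finite subset of \<open>J\<close> lies in the ideal of some initial segment, which misses the next
      term of \<open>a\<close>.\<close>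
    have spanJ: "ideal_span ?P T \<subseteq> J" and not_fg: "\<exists>x. x \<in> J - ideal_span ?P T"
      if T: "finite T" "T \<subseteq> J" for T
    proof -
      obtain m where "T \<subseteq> ideal_span ?P (a ` {..<m})"
        using bounded[OF T] by blast
      then have sub: "ideal_span ?P T \<subseteq> ideal_span ?P (a ` {..<m})"
        by (rule ideal_span_least[OF P])
      then show "ideal_span ?P T \<subseteq> J"
        unfolding J_def by blast
      have "a m \<in> ideal_span ?P (a ` {..<Suc m})"
        by (rule ideal_span_generator[OF P]) simp
      then have "a m \<in> J"
        unfolding J_def by blast
      with new[of m] sub show "\<exists>x. x \<in> J - ideal_span ?P T" by blast
    qed
    define least where "least p n x \<longleftrightarrow> x \<in> J - ideal_span ?P (p ` {..<n}) \<and>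
        (\<forall>y \<in> J - ideal_span ?P (p ` {..<n}). degree x \<le> degree y)"
      for p :: "nat \<Rightarrow> 'a poly" and n x
    have "\<exists>p. \<forall>n. least p n (p n)"
    proof (rule dependent_wellorder_choice)
      fix x n and f g :: "nat \<Rightarrow> 'a poly"
      assume "\<And>m. m < n \<Longrightarrow> f m = g m"
      then have "f ` {..<n} = g ` {..<n}"
        by (intro image_cong) auto
      then show "least f n x = least g n x"
        unfolding least_def by simp
    next
      fix n and f :: "nat \<Rightarrow> 'a poly"
      assume "\<And>m. m < n \<Longrightarrow> least f m (f m)"
      then have "\<exists>x. x \<in> J - ideal_span ?P (f ` {..<n})"
        by (intro not_fg) (auto simp: least_def)
      then show "\<exists>x. least f n x"
        unfolding least_def Ball_def
        using ex_has_least_nat[of "\<lambda>x. x \<in> J - ideal_span ?P (f ` {..<n})" _ degree] by blast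
    qed
    then obtain p where p: "\<And>n. least p n (p n)" by blast
    have pJ: "p n \<in> J" and p_new: "p n \<notin> ideal_span ?P (p ` {..<n})" for n
      using p[of n] unfolding least_def by auto
    have p_min: "degree (p n) \<le> degree y" if "y \<in> J" "y \<notin> ideal_span ?P (p ` {..<n})" for n y
      using p[of n] that unfolding least_def by blast
    have "range (\<lambda>n. lead_coeff (p n)) \<subseteq> R"
      using pJ JP unfolding polys_over_def by blast
    then obtain n where n: "lead_coeff (p n) \<in> ideal_span R ((\<lambda>n. lead_coeff (p n)) ` {..<n})"
      using assms unfolding noetherian_subring_def by blast
    \<comment> \<open>The ideals to be avoided increase, so minimality makes the degrees increase.\<close>
    have le: "degree (p i) \<le> degree (p n)" if "i < n" for i
    proof (rule p_min[OF pJ])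
      have "ideal_span ?P (p ` {..<i}) \<subseteq> ideal_span ?P (p ` {..<n})"
        using that by (intro ideal_span_mono) auto
      then show "p n \<notin> ideal_span ?P (p ` {..<i})"
        using p_new[of n] by blast
    qed
    obtain q where q: "q \<in> ideal_span ?P (p ` {..<n})" "degree q \<le> degree (p n)"
        "coeff q (degree (p n)) = lead_coeff (p n)"
      using lift_leading_coefficient[OF R, of "p ` {..<n}" "degree (p n)" "lead_coeff (p n)"] n le
      by (auto simp: image_image)
    have "q \<in> J"
      using q(1) spanJ[of "p ` {..<n}"] pJ by blast
    then have "p n - q \<in> J"
      by (rule Jdiff[OF pJ])
    moreover have "p n - q \<notin> ideal_span ?P (p ` {..<n})"
      using ideal_span_add[OF _ q(1), of "p n - q"] p_new[of n] by auto
    ultimately have "degree (p n) \<le> degree (p n - q)" and "p n - q \<noteq> 0"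
      by (auto intro: p_min ideal_span.zero)
    moreover have "degree (p n - q) \<le> degree (p n)"
      using q(2) by (intro degree_diff_le) auto
    \<comment> \<open>Minimality of \<open>p n\<close> forces equality of degrees, although the top coefficients cancel.\<close>
    ultimately have "coeff (p n - q) (degree (p n)) \<noteq> 0"
      by (metis le_antisym leading_coeff_0_iff)
    with q(3) show False by simp
  qed
  with P show ?thesis
    unfolding noetherian_subring_def by blast
qed

lemma noetherian_adjoin:
  fixes f :: "'a::comm_ring_1"
  assumes "noetherian_subring R"
  shows "noetherian_subring ((\<lambda>p. poly p f) ` polys_over R)"
proof -
  have R: "noetherian_subring (polys_over R)"
    by (rule Hilbert_basis[OF assms])
  then have P: "unital_subring (polys_over R)"
    by (simp add: noetherian_subring_def)
  let ?A = "(\<lambda>p. poly p f) ` polys_over R"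
  have "1 \<in> ?A"
    by (rule image_eqI[of _ _ 1]) (auto intro: unital_subring_closed[OF P])
  moreover have "x - y \<in> ?A \<and> x * y \<in> ?A" if xy: "x \<in> ?A" "y \<in> ?A" for x y
  proof -
    from xy obtain p q where "p \<in> polys_over R" "q \<in> polys_over R" "x = poly p f" "y = poly q f"
      by blast
    then show ?thesis
      using unital_subring_closed(3,6)[OF P, of p q]
      by (metis (no_types, lifting) image_eqI poly_diff poly_mult)
  qed
  ultimately have "unital_subring ?A"
    unfolding unital_subring_def by blast
  moreover have "\<exists>n. a n \<in> ideal_span ?A (a ` {..<n})" if "range a \<subseteq> ?A" for a :: "nat \<Rightarrow> 'a"
  proof -
    have "\<forall>n. \<exists>p. p \<in> polys_over R \<and> a n = poly p f"
      using that by blast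
    then obtain b where b: "\<And>n. b n \<in> polys_over R" "\<And>n. a n = poly (b n) f"
      by metis
    then obtain n where "b n \<in> ideal_span (polys_over R) (b ` {..<n})"
      using R unfolding noetherian_subring_def by blast
    moreover have "poly p f \<in> ideal_span ?A (a ` {..<n})"
      if "p \<in> ideal_span (polys_over R) (b ` {..<n})" for p
      using that by induction (auto simp: b(2) intro!: ideal_span.intros)
    ultimately show ?thesis
      using b(2) by auto
  qed
  ultimately show ?thesis
    unfolding noetherian_subring_def by blast
qed

lemma poly_in_unital_subring:
  assumes Q: "unital_subring Q" and "p \<in> polys_over Q" and "f \<in> Q"
  shows "poly p f \<in> Q"
  unfolding poly_altdef using assms
  by (auto simp: polys_over_def intro!: unital_subring_sum[OF Q] unital_subring_closed[OF Q]
      unital_subring_power[OF Q])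

text \<open>The ring generated by \<open>K\<close> and \<open>B\<close>, described by its universal property: leastness turns the claim
that \<open>R\<close> is stable under a ring endomorphism of the ambient type into a check on the generators.\<close>

theorem finitely_generated_noetherian:
  assumes K: "noetherian_subring K" and "finite B"
  shows "\<exists>R. noetherian_subring R \<and> K \<union> B \<subseteq> R \<and>
    (\<forall>Q. unital_subring Q \<longrightarrow> K \<union> B \<subseteq> Q \<longrightarrow> R \<subseteq> Q)"
  using \<open>finite B\<close>
proof induction
  case empty
  show ?case
    using K by (intro exI[of _ K]) simp
next
  case (insert f B)
  then obtain R where R: "noetherian_subring R" "K \<union> B \<subseteq> R"
    "\<And>Q. unital_subring Q \<Longrightarrow> K \<union> B \<subseteq> Q \<Longrightarrow> R \<subseteq> Q" by blast
  have Rs: "unital_subring R"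
    using R(1) noetherian_subring_def by blast
  let ?A = "(\<lambda>p. poly p f) ` polys_over R"
  have "r \<in> ?A" if "r \<in> R" for r
    using monom_in_polys_over[OF Rs that, of 0] by (intro image_eqI[of _ _ "monom r 0"]) (auto simp: poly_monom)
  moreover have "f \<in> ?A"
    using monom_in_polys_over[OF Rs unital_subring_closed(2)[OF Rs], of 1]
    by (intro image_eqI[of _ _ "monom 1 1"]) (auto simp: poly_monom)
  ultimately have "K \<union> insert f B \<subseteq> ?A"
    using R(2) by blast
  moreover have "?A \<subseteq> Q" if Q: "unital_subring Q" "K \<union> insert f B \<subseteq> Q" for Q
  proof -
    have "R \<subseteq> Q"
      using Q by (intro R(3)) auto
    then have "polys_over R \<subseteq> polys_over Q"
      by (auto simp: polys_over_def)
    then show ?thesis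
      using Q by (auto intro!: poly_in_unital_subring)
  qed
  ultimately show ?case
    using noetherian_adjoin[OF R(1), of f] by blast
qed

section \<open>Zero loci of Noetherian rings of functions\<close>

definition const_functions :: "('x \<Rightarrow> 'f::field) set"
  where "const_functions = range (\<lambda>c x. c)"

lemma noetherian_const_functions: "noetherian_subring (const_functions :: ('x \<Rightarrow> 'f::field) set)"
proof -
  have "unital_subring (const_functions :: ('x \<Rightarrow> 'f) set)"
    by (auto simp: unital_subring_def const_functions_def fun_eq_iff)
  moreover have "\<exists>n. a n \<in> ideal_span const_functions (a ` {..<n})"
    if "range a \<subseteq> const_functions" for a :: "nat \<Rightarrow> 'x \<Rightarrow> 'f"
  \<comment> \<open>In a field the first two terms decide: the empty combination gives \<open>a 0\<close>, or \<open>a 0\<close> is a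
    unit and generates \<open>a 1\<close>.\<close>
  proof (cases "a 0 = 0")
    case True
    then show ?thesis
      by (intro exI[of _ 0]) (auto intro: ideal_span.zero)
  next
    case False
    have "a 0 \<in> const_functions" "a 1 \<in> const_functions"
      using that by auto
    then obtain c d where cd: "a 0 = (\<lambda>x. c)" "a 1 = (\<lambda>x. d)"
      unfolding const_functions_def by blast
    with False have "c \<noteq> 0" by (auto simp: fun_eq_iff)
    have "(\<lambda>x. d / c) * a 0 + 0 \<in> ideal_span const_functions (a ` {..<1})"
      by (intro ideal_span.intros) (auto simp: const_functions_def)
    moreover have "(\<lambda>x. d / c) * a 0 + 0 = a 1"
      using cd \<open>c \<noteq> 0\<close> by (auto simp: fun_eq_iff)
    ultimately have "a 1 \<in> ideal_span const_functions (a ` {..<1})"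
      by simp
    then show ?thesis ..
  qed
  ultimately show ?thesis
    by (simp add: noetherian_subring_def)
qed

text \<open>Zariski closedness, in separation form: each point outside \<open>V\<close> is detected by a function of \<open>R\<close>
that vanishes on \<open>V\<close>.\<close>

definition zero_locus_in :: "'x set \<Rightarrow> ('x \<Rightarrow> 'f::field) set \<Rightarrow> 'x set \<Rightarrow> bool"
  where "zero_locus_in X R V \<longleftrightarrow>
    V \<subseteq> X \<and> (\<forall>x \<in> X - V. \<exists>p \<in> R. (\<forall>v\<in>V. p v = 0) \<and> p x \<noteq> 0)"

text \<open>Thin out a chain that does not stabilize until it descends strictly, and pick for each step
a function that vanishes on the smaller set but not at a point \<open>x\<close> of the larger one. If the \<open>n\<close>-th
function were a combination of the earlier ones, it would vanish at its own point \<open>x\<close>, since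
that point lies in all the earlier, smaller sets.\<close>

lemma zero_locus_chain_stabilizes:
  fixes R :: "('x \<Rightarrow> 'f::field) set"
  assumes R: "noetherian_subring R" and V: "\<And>k. zero_locus_in X R (V k)"
    and dec: "\<And>k. V (Suc k) \<subseteq> V k"
  shows "\<exists>n0. \<forall>m\<ge>n0. V m = V n0"
proof (rule ccontr)
  assume contra: "\<not> ?thesis"
  have anti: "V n \<subseteq> V m" if "m \<le> n" for m n
    using lift_Suc_antimono_le[of V, OF dec that] .
  have "\<exists>p x k. m \<le> k \<and> x \<in> V m \<and> p \<in> R \<and> (\<forall>v\<in>V k. p v = 0) \<and> p x \<noteq> 0" for m
  proof -
    obtain k where k: "k \<ge> m" "V k \<noteq> V m"
      using contra by blast
    with anti obtain x where "x \<in> V m - V k" by blast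
    then show ?thesis
      using V[of k] V[of m] k(1) unfolding zero_locus_in_def by blast
  qed
  then obtain p x k where pxk: "\<And>m. m \<le> k m" "\<And>m. x m \<in> V m" "\<And>m. p m \<in> R"
      "\<And>m v. v \<in> V (k m) \<Longrightarrow> p m v = 0" "\<And>m. p m (x m) \<noteq> 0"
    by metis
  \<comment> \<open>Iterating \<open>k\<close> passes to the strictly descending subsequence.\<close>
  define s where "s n = (k ^^ n) 0" for n
  have s_mono: "s m \<le> s n" if "m \<le> n" for m n
    by (rule lift_Suc_mono_le[of s, OF _ that]) (simp add: s_def pxk(1))
  obtain n where n: "p (s n) \<in> ideal_span R ((\<lambda>i. p (s i)) ` {..<n})"
    using R pxk(3) unfolding noetherian_subring_def by (metis (mono_tags, lifting) image_subset_iff)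
  have "q (x (s n)) = 0" if "q \<in> ideal_span R ((\<lambda>i. p (s i)) ` {..<n})" for q
    using that
  proof induction
    case (step r t y)
    then obtain i where i: "i < n" "t = p (s i)" by auto
    have "k (s i) \<le> s n"
      using s_mono[of "Suc i" n] i(1) by (simp add: s_def)
    then have "x (s n) \<in> V (k (s i))"
      using anti pxk(2) by blast
    with step.IH i(2) pxk(4) show ?case by simp
  qed simp
  with n pxk(5) show False by blast
qed

section \<open>The group theory of envelopes\<close>

text \<open>Normality of \<open>N\<close> in \<open>S\<close>, expressed with the operations of \<open>G\<close>, so that \<open>S\<close> can be
replaced by a smaller subgroup without changing the group structure.\<close>

definition normal_within :: "('g, 'm) monoid_scheme \<Rightarrow> 'g set \<Rightarrow> 'g set \<Rightarrow> bool"
  where "normal_within G S N \<longleftrightarrow>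
    subgroup N G \<and> N \<subseteq> S \<and> (\<forall>x\<in>S. \<forall>n\<in>N. x \<otimes>\<^bsub>G\<^esub> n \<otimes>\<^bsub>G\<^esub> inv\<^bsub>G\<^esub> x \<in> N)"

text \<open>If \<open>N\<close> is normal in \<open>S\<close> and \<open>A \<subseteq> S\<close>, this is the preimage in \<open>S\<close> of the centralizer of the image of
\<open>A\<close> in \<open>S/N\<close>. Iterated centralizers and envelopes are both of this shape.\<close>

definition centralizer_mod :: "('g, 'm) monoid_scheme \<Rightarrow> 'g set \<Rightarrow> 'g set \<Rightarrow> 'g set \<Rightarrow> 'g set"
  where "centralizer_mod G S A N = {x \<in> S. \<forall>a\<in>A. commutator G x a \<in> N}"

abbreviation envelope_centralizer :: "('g, 'm) monoid_scheme \<Rightarrow> 'g set \<Rightarrow> nat \<Rightarrow> nat \<Rightarrow> 'g set"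
  where "envelope_centralizer G H k \<equiv> iterated_centralizer (G\<lparr>carrier := envelope G H k\<rparr>) H"

context group
begin

lemma inv_mult_cancel:
  assumes "x \<in> carrier G" "y \<in> carrier G"
  shows "inv x \<otimes> (x \<otimes> y) = y" "x \<otimes> (inv x \<otimes> y) = y"
  using assms by (simp_all flip: m_assoc)

lemma commutator_identities:
  assumes "x \<in> carrier G" "a \<in> carrier G"
  shows commutator_one: "commutator G \<one> a = \<one>"
    and commutator_inverse: "inv (commutator G x a) = commutator G a x"
    and commutator_inv: "commutator G (inv x) a = x \<otimes> inv (commutator G x a) \<otimes> inv x"
    and commutator_conjugate: "commutator G x a = inv x \<otimes> (inv a \<otimes> x \<otimes> inv (inv a))"
    and conjugate_commutator: "x \<otimes> a \<otimes> inv x = a \<otimes> commutator G a (inv x)"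
  using assms by (simp_all add: commutator_def m_assoc inv_mult_group inv_mult_cancel)

lemma commutator_mult:
  assumes "x \<in> carrier G" "y \<in> carrier G" "a \<in> carrier G"
  shows "commutator G (x \<otimes> y) a
    = (inv y \<otimes> commutator G x a \<otimes> inv (inv y)) \<otimes> commutator G y a"
  using assms by (simp add: commutator_def m_assoc inv_mult_group inv_mult_cancel)

lemma commutator_subgroup:
  assumes "subgroup S G" "x \<in> S" "y \<in> S"
  shows "commutator (G\<lparr>carrier := S\<rparr>) x y = commutator G x y"
  using assms by (simp add: commutator_def)

lemma normal_within_conjugate:
  assumes "normal_within G S N" "x \<in> S" "n \<in> N"
  shows "x \<otimes> n \<otimes> inv x \<in> N"
  using assms unfolding normal_within_def by blast

lemma normalizer_of_normal_within:
  assumes S: "subgroup S G" and N: "normal_within G S N"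
  shows "normalizer (G\<lparr>carrier := S\<rparr>) N = S"
proof -
  have NS: "N \<subseteq> S" and NG: "N \<subseteq> carrier G"
    using N subgroup.subset unfolding normal_within_def by blast+
  have SG: "S \<subseteq> carrier G"
    by (rule subgroup.subset[OF S])
  have "x <#\<^bsub>G\<lparr>carrier := S\<rparr>\<^esub> N #>\<^bsub>G\<lparr>carrier := S\<rparr>\<^esub> inv\<^bsub>G\<lparr>carrier := S\<rparr>\<^esub> x = N"
    if x: "x \<in> S" for x
  proof -
    have "n \<in> (\<lambda>n. x \<otimes> n \<otimes> inv x) ` N" if n: "n \<in> N" for n
    proof (rule image_eqI)
      have "inv x \<otimes> n \<otimes> inv (inv x) \<in> N"
        by (rule normal_within_conjugate[OF N subgroup.m_inv_closed[OF S x] n])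
      then show "inv x \<otimes> n \<otimes> x \<in> N"
        using x SG by auto
      have "x \<in> carrier G" "n \<in> carrier G"
        using x n SG NG by auto
      then show "n = x \<otimes> (inv x \<otimes> n \<otimes> x) \<otimes> inv x"
        by (simp add: m_assoc inv_mult_cancel)
    qed
    then have "(\<lambda>n. x \<otimes> n \<otimes> inv x) ` N = N"
      using normal_within_conjugate[OF N x] by blast
    then show ?thesis
      using S x by (auto simp: l_coset_def r_coset_def)
  qed
  with NS show ?thesis
    by (auto simp: normalizer_def stabilizer_def)
qed

text \<open>Normal subgroups have full normalizer, so the normalizer conditions in the definition are void.\<close>

lemma iterated_centralizer_Suc_normal:
  assumes S: "subgroup S G" and "H \<subseteq> S"
    and "\<And>n. n \<le> k \<Longrightarrow> normal_within G S (iterated_centralizer (G\<lparr>carrier := S\<rparr>) H n)"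
  shows "iterated_centralizer (G\<lparr>carrier := S\<rparr>) H (Suc k)
    = centralizer_mod G S H (iterated_centralizer (G\<lparr>carrier := S\<rparr>) H k)"
proof -
  have "(\<Inter>n\<in>{..<Suc k}. normalizer (G\<lparr>carrier := S\<rparr>) (iterated_centralizer (G\<lparr>carrier := S\<rparr>) H n)) = S"
    using normalizer_of_normal_within[OF S] assms(3) by auto
  then show ?thesis
    using commutator_subgroup[OF S] \<open>H \<subseteq> S\<close>
    by (auto simp: centralizer_mod_def commutator_set_def subset_iff simp del: lessThan_Suc)
qed

lemma subgroup_centralizer_mod:
  assumes S: "subgroup S G" and A: "A \<subseteq> carrier G" and N: "normal_within G S N"
  shows "subgroup (centralizer_mod G S A N) G"
proof -
  have SG: "S \<subseteq> carrier G" and sN: "subgroup N G"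
    using subgroup.subset[OF S] N unfolding normal_within_def by auto
  show ?thesis
  proof (rule subgroupI)
    show "centralizer_mod G S A N \<subseteq> carrier G"
      using SG by (auto simp: centralizer_mod_def)
    have "\<one> \<in> centralizer_mod G S A N"
      using A subgroup.one_closed[OF S] subgroup.one_closed[OF sN]
      by (auto simp: centralizer_mod_def subset_iff commutator_one[OF one_closed])
    then show "centralizer_mod G S A N \<noteq> {}" by blast
  next
    fix x assume "x \<in> centralizer_mod G S A N"
    then have x: "x \<in> S" "\<And>a. a \<in> A \<Longrightarrow> commutator G x a \<in> N"
      by (auto simp: centralizer_mod_def)
    have "commutator G (inv x) a \<in> N" if "a \<in> A" for a
      using normal_within_conjugate[OF N x(1) subgroup.m_inv_closed[OF sN x(2)[OF that]]]
        that x(1) A SG by (simp add: commutator_inv subset_iff)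
    then show "inv x \<in> centralizer_mod G S A N"
      using subgroup.m_inv_closed[OF S x(1)] by (simp add: centralizer_mod_def)
  next
    fix x y assume "x \<in> centralizer_mod G S A N" "y \<in> centralizer_mod G S A N"
    then have x: "x \<in> S" "\<And>a. a \<in> A \<Longrightarrow> commutator G x a \<in> N"
      and y: "y \<in> S" "\<And>a. a \<in> A \<Longrightarrow> commutator G y a \<in> N"
      by (auto simp: centralizer_mod_def)
    have "commutator G (x \<otimes> y) a \<in> N" if a: "a \<in> A" for a
    proof -
      have "commutator G (x \<otimes> y) a
          = (inv y \<otimes> commutator G x a \<otimes> inv (inv y)) \<otimes> commutator G y a"
        using x(1) y(1) a A SG by (intro commutator_mult) auto
      also have "\<dots> \<in> N"
        using normal_within_conjugate[OF N subgroup.m_inv_closed[OF S y(1)] x(2)[OF a]] y(2)[OF a]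
        by (rule subgroup.m_closed[OF sN])
      finally show ?thesis .
    qed
    then show "x \<otimes> y \<in> centralizer_mod G S A N"
      using subgroup.m_closed[OF S x(1) y(1)] by (simp add: centralizer_mod_def)
  qed
qed

lemma normal_within_subset_centralizer_mod:
  assumes S: "subgroup S G" and A: "A \<subseteq> S" and N: "normal_within G S N"
  shows "N \<subseteq> centralizer_mod G S A N"
proof -
  have NS: "N \<subseteq> S" and sN: "subgroup N G"
    using N unfolding normal_within_def by auto
  have "commutator G n a \<in> N" if n: "n \<in> N" and a: "a \<in> A" for n a
  proof -
    have aS: "a \<in> S" using a A by blast
    have "commutator G n a = inv n \<otimes> (inv a \<otimes> n \<otimes> inv (inv a))"
      using n aS subgroup.subset[OF sN] subgroup.subset[OF S] by (intro commutator_conjugate) auto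
    also have "\<dots> \<in> N"
      by (intro subgroup.m_closed[OF sN] subgroup.m_inv_closed[OF sN n]
          normal_within_conjugate[OF N _ n] subgroup.m_inv_closed[OF S aS])
    finally show ?thesis .
  qed
  with NS show ?thesis
    by (auto simp: centralizer_mod_def)
qed

lemma envelope_Suc:
  assumes E: "subgroup (envelope G H k) G" and C: "envelope_centralizer G H k (Suc k) \<subseteq> envelope G H k"
  shows "envelope G H (Suc k) = centralizer_mod G (envelope G H k)
    (envelope_centralizer G H k (Suc k)) (envelope_centralizer G H k k)"
proof -
  have "commutator_set (G\<lparr>carrier := envelope G H k\<rparr>) g (envelope_centralizer G H k (Suc k))
      = commutator G g ` envelope_centralizer G H k (Suc k)" if "g \<in> envelope G H k" for g
    using C commutator_subgroup[OF E that]
    by (force simp: commutator_set_def image_def simp del: iterated_centralizer.simps)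
  then show ?thesis
    by (auto simp: Let_def centralizer_mod_def simp del: iterated_centralizer.simps)
qed

definition envelope_normality :: "'a set \<Rightarrow> nat \<Rightarrow> bool"
  where "envelope_normality H k \<longleftrightarrow> subgroup (envelope G H k) G \<and> H \<subseteq> envelope G H k \<and>
    (\<forall>j\<le>k. normal_within G (envelope G H k) (envelope_centralizer G H k j))"

text \<open>The inductive step that carries the whole analysis of envelopes: the formulas for the next
envelope and its centralizers are consequences of normality at stage \<open>k\<close>, and they in turn give
normality at stage \<open>k + 1\<close>.\<close>

lemma envelope_normality_step:
  assumes inv: "envelope_normality H k"
  shows "envelope G H (Suc k) = centralizer_mod G (envelope G H k)
      (centralizer_mod G (envelope G H k) H (envelope_centralizer G H k k))
      (envelope_centralizer G H k k)"
    and "j \<le> k \<Longrightarrow> envelope_centralizer G H (Suc k) j = envelope_centralizer G H k j"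
    and "envelope_centralizer G H (Suc k) (Suc k)
      = centralizer_mod G (envelope G H (Suc k)) H (envelope_centralizer G H k k)"
    and "envelope_normality H (Suc k)"
proof -
  define E where "E = envelope G H k"
  define E' where "E' = envelope G H (Suc k)"
  define C where "C = iterated_centralizer (G\<lparr>carrier := E\<rparr>) H"
  define C' where "C' = iterated_centralizer (G\<lparr>carrier := E'\<rparr>) H"
  have E: "subgroup E G" and HE: "H \<subseteq> E" and norm: "\<And>j. j \<le> k \<Longrightarrow> normal_within G E (C j)"
    using inv unfolding envelope_normality_def E_def C_def by auto
  have EG: "E \<subseteq> carrier G"
    by (rule subgroup.subset[OF E])
  have C_Suc: "C (Suc j) = centralizer_mod G E H (C j)" if "j \<le> k" for j
    unfolding C_def using norm that unfolding C_def
    by (intro iterated_centralizer_Suc_normal[OF E HE]) auto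
  have CE: "C (Suc k) \<subseteq> E"
    by (auto simp: C_Suc centralizer_mod_def)
  have E'_eq: "E' = centralizer_mod G E (C (Suc k)) (C k)"
    using envelope_Suc[of H k] E CE unfolding E'_def E_def C_def by blast
  have sCk: "subgroup (C k) G"
    using norm unfolding normal_within_def by blast
  have sC: "subgroup (C (Suc k)) G"
    using subgroup_centralizer_mod[OF E _ norm, of H k] HE EG C_Suc[of k] by auto
  have E': "subgroup E' G"
    using subgroup_centralizer_mod[OF E _ norm, of "C (Suc k)" k] CE EG E'_eq by auto
  have E'E: "E' \<subseteq> E"
    by (auto simp: E'_eq centralizer_mod_def)
  \<comment> \<open>\<open>H\<close> lies in its own double centralizer modulo \<open>C k\<close>.\<close>
  have HE': "H \<subseteq> E'"
  proof
    fix h assume h: "h \<in> H"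
    have "commutator G h c \<in> C k" if c: "c \<in> C (Suc k)" for c
    proof -
      have "commutator G c h \<in> C k"
        using c h by (simp add: C_Suc centralizer_mod_def)
      then have "inv (commutator G c h) \<in> C k"
        by (rule subgroup.m_inv_closed[OF sCk])
      then show ?thesis
        using commutator_inverse[of c h] c h CE HE EG by (auto simp: subset_iff)
    qed
    then show "h \<in> E'"
      using h HE by (auto simp: E'_eq centralizer_mod_def)
  qed
  have C_incr: "C j \<subseteq> C (Suc j)" if "j \<le> k" for j
    using normal_within_subset_centralizer_mod[OF E HE norm[OF that]] C_Suc[OF that] by simp
  have C_sub: "j \<le> k \<Longrightarrow> C j \<subseteq> C k" for j
    by (induction rule: inc_induct) (use C_incr less_imp_le in blast)+
  have CkE': "C k \<subseteq> E'"
    unfolding E'_eq by (rule normal_within_subset_centralizer_mod[OF E CE norm]) simp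
  have norm': "normal_within G E' (C j)" if "j \<le> k" for j
    using norm[OF that] C_sub[OF that] CkE' E'E unfolding normal_within_def by blast
  \<comment> \<open>Inductively, the centralizers of \<open>H\<close> in \<open>E'\<close> are those in \<open>E\<close> cut down to \<open>E'\<close>, and up to
    index \<open>k\<close> nothing is lost because \<open>C k \<subseteq> E'\<close>.\<close>
  have C'_eq: "j \<le> k \<Longrightarrow> C' j = C j" for j
  proof (induction j rule: less_induct)
    case (less j)
    show ?case
    proof (cases j)
      case 0
      then show ?thesis by (simp add: C'_def C_def)
    next
      case (Suc i)
      have "C' j = centralizer_mod G E' H (C' i)"
        unfolding C'_def Suc
        by (rule iterated_centralizer_Suc_normal[OF E' HE'])
          (use less norm' Suc in \<open>simp flip: C'_def\<close>)
      also have "\<dots> = E' \<inter> C j"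
        using less Suc E'E by (auto simp: C_Suc centralizer_mod_def)
      finally show ?thesis
        using C_sub[OF less.prems] CkE' by blast
    qed
  qed
  have C'_Suc: "C' (Suc k) = centralizer_mod G E' H (C k)"
  proof -
    have "C' (Suc k) = centralizer_mod G E' H (C' k)"
      unfolding C'_def
      by (rule iterated_centralizer_Suc_normal[OF E' HE']) (use norm' C'_eq in \<open>simp flip: C'_def\<close>)
    then show ?thesis by (simp add: C'_eq)
  qed
  then have C'_Int: "C' (Suc k) = E' \<inter> C (Suc k)"
    using E'E by (auto simp: C_Suc centralizer_mod_def)
  \<comment> \<open>Elements of \<open>E'\<close> commute with \<open>C (Suc k)\<close> modulo \<open>C k\<close>, and \<open>C k\<close> is contained in
    \<open>C' (Suc k)\<close>: conjugation moves \<open>n\<close> only by a factor from \<open>C k\<close>.\<close>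
  have "normal_within G E' (C' (Suc k))"
    unfolding normal_within_def
  proof (intro conjI ballI)
    show s: "subgroup (C' (Suc k)) G"
      unfolding C'_Int by (rule subgroups_Inter_pair[OF E' sC])
    show "C' (Suc k) \<subseteq> E'"
      by (simp add: C'_Int)
    fix x n assume x: "x \<in> E'" and n: "n \<in> C' (Suc k)"
    have xG: "x \<in> carrier G" "inv x \<in> carrier G" and nG: "n \<in> carrier G"
      using x n E'E EG by (auto simp: C'_Int)
    have "commutator G (inv x) n \<in> C k"
      using subgroup.m_inv_closed[OF E' x] n by (simp add: E'_eq C'_Int centralizer_mod_def)
    then have "inv (commutator G (inv x) n) \<in> C k"
      by (rule subgroup.m_inv_closed[OF sCk])
    then have "commutator G n (inv x) \<in> C' (Suc k)"
      using commutator_inverse[OF xG(2) nG] C_incr[of k] CkE' by (auto simp: C'_Int)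
    then have "n \<otimes> commutator G n (inv x) \<in> C' (Suc k)"
      by (rule subgroup.m_closed[OF s n])
    then show "x \<otimes> n \<otimes> inv x \<in> C' (Suc k)"
      using conjugate_commutator[OF xG(1) nG] by simp
  qed
  then have "normal_within G E' (C' j)" if "j \<le> Suc k" for j
    using that norm' C'_eq by (cases "j = Suc k") auto
  with E' HE' show "envelope_normality H (Suc k)"
    unfolding envelope_normality_def E'_def C'_def by blast
  show "envelope G H (Suc k) = centralizer_mod G (envelope G H k)
      (centralizer_mod G (envelope G H k) H (envelope_centralizer G H k k))
      (envelope_centralizer G H k k)"
    using E'_eq C_Suc[of k] unfolding E'_def E_def C_def by simp
  show "envelope_centralizer G H (Suc k) j = envelope_centralizer G H k j" if "j \<le> k"
    using C'_eq[OF that] unfolding C'_def C_def E_def E'_def .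
  show "envelope_centralizer G H (Suc k) (Suc k)
      = centralizer_mod G (envelope G H (Suc k)) H (envelope_centralizer G H k k)"
    using C'_Suc unfolding C'_def C_def E_def E'_def .
qed

lemma envelope_normality:
  assumes "subgroup H G"
  shows "envelope_normality H k"
proof (induction k)
  case 0
  have "normal_within G (carrier G) {\<one>}"
    using triv_subgroup by (auto simp: normal_within_def)
  then show ?case
    using subgroup_self subgroup.subset[OF assms]
    by (simp add: envelope_normality_def)
qed (rule envelope_normality_step(4))

text \<open>The principle by which closedness passes to envelopes: any property of subsets that is
preserved by \<open>centralizer_mod\<close> can be followed along the chain. The set \<open>A\<close> is arbitrary: a condition
imposed for each \<open>a \<in> A\<close> amounts to an intersection, so only \<open>S\<close> and \<open>N\<close> need the property.\<close>

lemma envelope_induct: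
  assumes H: "subgroup H G" and "P (carrier G)" and "P {\<one>}"
    and cent: "\<And>S A N. P S \<Longrightarrow> P N \<Longrightarrow> S \<subseteq> carrier G \<Longrightarrow> A \<subseteq> carrier G \<Longrightarrow> P (centralizer_mod G S A N)"
  shows "P (envelope G H k)"
proof -
  \<comment> \<open>By the formulas of \<open>envelope_normality_step\<close>, the pair \<open>E\<^sub>k, C\<^sub>k\<close> determines the next one.\<close>
  have "P (envelope G H k) \<and> P (envelope_centralizer G H k k)"
  proof (induction k)
    case 0
    show ?case
      using assms(2,3) by simp
  next
    case (Suc k)
    have sub: "envelope G H n \<subseteq> carrier G" for n
      using envelope_normality[OF H] subgroup.subset unfolding envelope_normality_def by blast
    note step = envelope_normality_step[OF envelope_normality[OF H, of k]]
    have "P (envelope G H (Suc k))"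
      unfolding step(1) using Suc sub[of k]
      by (intro cent) (auto simp: centralizer_mod_def)
    moreover from this have "P (envelope_centralizer G H (Suc k) (Suc k))"
      unfolding step(3) using Suc sub[of "Suc k"] subgroup.subset[OF H]
      by (intro cent) auto
    ultimately show ?case ..
  qed
  then show ?thesis ..
qed

lemma envelope_Suc_subset: "envelope G H (Suc k) \<subseteq> envelope G H k"
  by (auto simp: Let_def)

end

section \<open>Envelopes as zero loci\<close>

text \<open>The condition \<open>[x,a] \<in> N\<close> is the pullback of a closed condition along \<open>x \<mapsto> [x,a]\<close>, and an
arbitrary intersection of closed sets is closed.\<close>

lemma zero_locus_in_centralizer_mod:
  assumes G: "group G"
    and pullback: "\<And>p a. p \<in> R \<Longrightarrow> a \<in> carrier G \<Longrightarrow> \<exists>q\<in>R. \<forall>x\<in>carrier G. q x = p (commutator G x a)"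
    and S: "zero_locus_in (carrier G) R S" and N: "zero_locus_in (carrier G) R N"
    and A: "A \<subseteq> carrier G"
  shows "zero_locus_in (carrier G) R (centralizer_mod G S A N)"
  unfolding zero_locus_in_def
proof (intro conjI ballI)
  have SG: "S \<subseteq> carrier G"
    using S by (simp add: zero_locus_in_def)
  then show "centralizer_mod G S A N \<subseteq> carrier G"
    by (auto simp: centralizer_mod_def)
  fix x assume x: "x \<in> carrier G - centralizer_mod G S A N"
  show "\<exists>p\<in>R. (\<forall>v\<in>centralizer_mod G S A N. p v = 0) \<and> p x \<noteq> 0"
  proof (cases "x \<in> S")
    case False
    then obtain p where "p \<in> R" "\<forall>v\<in>S. p v = 0" "p x \<noteq> 0"
      using S x unfolding zero_locus_in_def by blast
    then show ?thesis
      by (intro bexI[of _ p]) (auto simp: centralizer_mod_def)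
  next
    case True
    with x obtain a where a: "a \<in> A" "commutator G x a \<notin> N"
      by (auto simp: centralizer_mod_def)
    interpret group G by (rule G)
    have aG: "a \<in> carrier G"
      using a(1) A by blast
    then have "commutator G x a \<in> carrier G"
      using x by (simp add: commutator_def)
    then obtain p where p: "p \<in> R" "\<forall>v\<in>N. p v = 0" "p (commutator G x a) \<noteq> 0"
      using N a(2) unfolding zero_locus_in_def by blast
    obtain q where "q \<in> R" "\<forall>x\<in>carrier G. q x = p (commutator G x a)"
      using pullback[OF p(1) aG] by blast
    then show ?thesis
      using p(2,3) x a(1) SG by (intro bexI[of _ q]) (auto simp: centralizer_mod_def subset_iff)
  qed
qed

text \<open>The topological core, independent of matrices: it suffices that some Noetherian ring of functions
separates every other element from \<open>\<one>\<close> and is stable under pullback along \<open>x \<mapsto> [x,a]\<close>.\<close>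

theorem envelope_stabilizes_if_noetherian_functions:
  fixes G :: "('g, 'm) monoid_scheme" and R :: "('g \<Rightarrow> 'f::field) set"
  assumes G: "group G" and H: "subgroup H G"
    and R: "noetherian_subring R"
    and one: "zero_locus_in (carrier G) R {\<one>\<^bsub>G\<^esub>}"
    and pullback: "\<And>p a. p \<in> R \<Longrightarrow> a \<in> carrier G \<Longrightarrow> \<exists>q\<in>R. \<forall>x\<in>carrier G. q x = p (commutator G x a)"
  shows "\<exists>n0. \<forall>m\<ge>n0. envelope G H m = envelope G H n0"
proof (rule zero_locus_chain_stabilizes[OF R])
  interpret group G by (rule G)
  show "zero_locus_in (carrier G) R (envelope G H k)" for k
  proof (rule envelope_induct[OF H])
    show "zero_locus_in (carrier G) R (carrier G)"
      by (simp add: zero_locus_in_def)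
    show "zero_locus_in (carrier G) R (centralizer_mod G S A N)"
      if "zero_locus_in (carrier G) R S" "zero_locus_in (carrier G) R N" "A \<subseteq> carrier G" for S A N
      using zero_locus_in_centralizer_mod[OF G pullback that] .
  qed (fact one)
  show "envelope G H (Suc k) \<subseteq> envelope G H k" for k
    by (rule envelope_Suc_subset)
qed

section \<open>The ring of polynomial functions on a linear group\<close>

lemma linear_group_representation:
  fixes G :: "('g, 'm) monoid_scheme"
  assumes "linear_group TYPE('f::field) G"
  obtains n and \<rho> :: "'g \<Rightarrow> 'f::field mat" where
    "\<And>x. x \<in> carrier G \<Longrightarrow> \<rho> x \<in> carrier_mat n n"
    "\<And>x y. x \<in> carrier G \<Longrightarrow> y \<in> carrier G \<Longrightarrow> \<rho> (x \<otimes>\<^bsub>G\<^esub> y) = \<rho> x * \<rho> y"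
    "\<rho> \<one>\<^bsub>G\<^esub> = 1\<^sub>m n"
    "inj_on \<rho> (carrier G)"
proof -
  obtain n K \<rho> where G: "group G"
    and K: "subgroup K (general_linear_group TYPE('f) n)"
    and \<rho>: "\<rho> \<in> iso G ((general_linear_group TYPE('f) n)\<lparr>carrier := K\<rparr>)"
    using assms unfolding linear_group_def is_iso_def by blast
  let ?M = "ring_mat TYPE('f) n ()"
  interpret M: ring ?M by (rule ring_mat)
  have GL: "group (general_linear_group TYPE('f) n)"
    unfolding general_linear_group_def by (rule M.units_group)
  have KM: "K \<subseteq> carrier_mat n n"
    using subgroup.subset[OF K]
    by (auto simp: general_linear_group_def units_of_def Units_def ring_mat_simps)
  have hom: "\<rho> \<in> hom G ((general_linear_group TYPE('f) n)\<lparr>carrier := K\<rparr>)"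
    and inj: "inj_on \<rho> (carrier G)"
    using \<rho> by (auto simp: iso_iff)
  have "group_hom G ((general_linear_group TYPE('f) n)\<lparr>carrier := K\<rparr>) \<rho>"
    using G subgroup.subgroup_is_group[OF K GL] hom
    by (simp add: group_hom_def group_hom_axioms_def)
  from group_hom.hom_one[OF this] have "\<rho> \<one>\<^bsub>G\<^esub> = 1\<^sub>m n"
    by (simp add: general_linear_group_def units_of_def ring_mat_simps)
  moreover have "\<rho> x \<in> carrier_mat n n" if "x \<in> carrier G" for x
    using hom_in_carrier[OF hom that] KM by auto
  moreover have "\<rho> (x \<otimes>\<^bsub>G\<^esub> y) = \<rho> x * \<rho> y" if "x \<in> carrier G" "y \<in> carrier G" for x y
    using hom_mult[OF hom that]
    by (simp add: general_linear_group_def units_of_def ring_mat_simps)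
  ultimately show ?thesis
    using that inj by blast
qed

definition has_entries_in :: "('x \<Rightarrow> 'f::field) set \<Rightarrow> nat \<Rightarrow> ('x \<Rightarrow> 'f mat) \<Rightarrow> bool"
  where "has_entries_in R n M \<longleftrightarrow>
    (\<forall>x. M x \<in> carrier_mat n n) \<and> (\<forall>i<n. \<forall>j<n. (\<lambda>x. M x $$ (i, j)) \<in> R)"

lemma sum_fun_apply: "sum f I x = (\<Sum>i\<in>I. f i x)"
  by (induction I rule: infinite_finite_induct) auto

lemma has_entries_in_mult:
  assumes R: "unital_subring R" and M: "has_entries_in R n M" and N: "has_entries_in R n N"
  shows "has_entries_in R n (\<lambda>x. M x * N x)"
  unfolding has_entries_in_def
proof (intro conjI allI impI)
  show "M x * N x \<in> carrier_mat n n" for x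
    using M N by (auto simp: has_entries_in_def intro: mult_carrier_mat)
  fix i j assume ij: "i < n" "j < n"
  have "(\<lambda>x. (M x * N x) $$ (i, j)) = (\<Sum>k\<in>{0..<n}. (\<lambda>x. M x $$ (i, k)) * (\<lambda>x. N x $$ (k, j)))"
  proof
    fix x
    have "M x \<in> carrier_mat n n" "N x \<in> carrier_mat n n"
      using M N by (auto simp: has_entries_in_def)
    then show "(M x * N x) $$ (i, j) = (\<Sum>k\<in>{0..<n}. (\<lambda>x. M x $$ (i, k)) * (\<lambda>x. N x $$ (k, j))) x"
      using ij by (simp add: sum_fun_apply scalar_prod_def)
  qed
  also have "\<dots> \<in> R"
    using M N ij
    by (auto simp: has_entries_in_def intro!: unital_subring_sum[OF R] unital_subring_closed[OF R])
  finally show "(\<lambda>x. (M x * N x) $$ (i, j)) \<in> R" .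
qed

lemma has_entries_in_const:
  assumes "const_functions \<subseteq> R" and "A \<in> carrier_mat n n"
  shows "has_entries_in R n (\<lambda>x. A)"
  using assms by (auto simp: has_entries_in_def const_functions_def)

theorem corollary3p2p4:
  fixes G :: "('g, 'm) monoid_scheme" and H :: "'g set"
  assumes "linear_group TYPE('f::field) G"
    and "subgroup H G"
  shows "\<exists>n0::nat. \<forall>m\<ge>n0. envelope G H m = envelope G H n0"
proof -
  have G: "group G"
    using assms(1) by (simp add: linear_group_def)
  interpret group G by (rule G)
  obtain n and \<rho> :: "'g \<Rightarrow> 'f mat" where
    \<rho>: "\<And>x. x \<in> carrier G \<Longrightarrow> \<rho> x \<in> carrier_mat n n"
    and mult: "\<And>x y. x \<in> carrier G \<Longrightarrow> y \<in> carrier G \<Longrightarrow> \<rho> (x \<otimes>\<^bsub>G\<^esub> y) = \<rho> x * \<rho> y"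
    and \<rho>1: "\<rho> \<one>\<^bsub>G\<^esub> = 1\<^sub>m n" and inj: "inj_on \<rho> (carrier G)"
    using linear_group_representation[OF assms(1)] by metis
  \<comment> \<open>Adjoining the entries of the inverse matrix as separate generators avoids dividing by a
    determinant. Elements of the type outside the carrier are sent to the identity matrix, and
    \<open>\<phi>\<close> below fixes them, so that the polynomial formulas for the commutator hold on the whole type.\<close>
  define X where "X x = (if x \<in> carrier G then \<rho> x else 1\<^sub>m n)" for x
  define Y where "Y x = (if x \<in> carrier G then \<rho> (inv\<^bsub>G\<^esub> x) else 1\<^sub>m n)" for x
  define entries where "entries M = (\<lambda>(i, j) x. M x $$ (i, j)) ` ({..<n} \<times> {..<n})"
    for M :: "'g \<Rightarrow> 'f mat"
  have fin: "finite (entries X \<union> entries Y)"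
    by (simp add: entries_def)
  obtain R where R: "noetherian_subring R"
    and gens: "const_functions \<union> (entries X \<union> entries Y) \<subseteq> R"
    and least: "\<And>Q. unital_subring Q \<Longrightarrow> const_functions \<union> (entries X \<union> entries Y) \<subseteq> Q \<Longrightarrow> R \<subseteq> Q"
    using finitely_generated_noetherian[OF noetherian_const_functions fin] by blast
  have Rs: "unital_subring R"
    using R by (simp add: noetherian_subring_def)
  have X: "has_entries_in R n X" and Y: "has_entries_in R n Y"
    using gens \<rho> by (auto simp: has_entries_in_def entries_def X_def Y_def)
  show ?thesis
  proof (rule envelope_stabilizes_if_noetherian_functions[OF G assms(2) R])
    have "\<exists>p\<in>R. p \<one>\<^bsub>G\<^esub> = 0 \<and> p x \<noteq> 0" if x: "x \<in> carrier G" "x \<noteq> \<one>\<^bsub>G\<^esub>" for x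
    proof -
      have "\<rho> x \<noteq> 1\<^sub>m n"
        using inj_onD[OF inj, of x "\<one>\<^bsub>G\<^esub>"] x \<rho>1 by auto
      then obtain i j where ij: "i < n" "j < n" "\<rho> x $$ (i, j) \<noteq> 1\<^sub>m n $$ (i, j)"
        using \<rho>[OF x(1)] eq_matI[of "1\<^sub>m n" "\<rho> x"] by (auto simp del: index_one_mat(1))
      have "(\<lambda>x. X x $$ (i, j)) - (\<lambda>_. 1\<^sub>m n $$ (i, j)) \<in> R"
        using X gens ij(1,2)
        by (intro unital_subring_closed(3)[OF Rs]) (auto simp: has_entries_in_def const_functions_def)
      then show ?thesis
        by (rule bexI[rotated]) (use ij(3) x \<rho>1 in \<open>auto simp: X_def\<close>)
    qed
    then show "zero_locus_in (carrier G) R {\<one>\<^bsub>G\<^esub>}"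
      by (auto simp: zero_locus_in_def)
  next
    fix p a assume p: "p \<in> R" and a: "a \<in> carrier G"
    \<comment> \<open>Pullback along \<open>\<phi>\<close> is a ring endomorphism, so it is enough to see that it maps the
      generators of \<open>R\<close> into \<open>R\<close>.\<close>
    define \<phi> where "\<phi> x = (if x \<in> carrier G then commutator G x a else x)" for x
    let ?A = "\<rho> a" and ?B = "\<rho> (inv\<^bsub>G\<^esub> a)"
    have BA: "?B * ?A = 1\<^sub>m n"
      using mult[of "inv\<^bsub>G\<^esub> a" a] a \<rho>1 by simp
    have AB: "has_entries_in R n (\<lambda>x. ?A)" "has_entries_in R n (\<lambda>x. ?B)"
      using gens \<rho> a by (auto intro!: has_entries_in_const)
    have carr: "?A \<in> carrier_mat n n" "?B \<in> carrier_mat n n"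
      using \<rho> a by auto
    have X\<phi>: "X (\<phi> x) = Y x * ?B * X x * ?A" for x
      using a carr BA by (auto simp: X_def Y_def \<phi>_def commutator_def mult)
    have Y\<phi>: "Y (\<phi> x) = ?B * Y x * ?A * X x" for x
    proof (cases "x \<in> carrier G")
      case True
      then have "inv\<^bsub>G\<^esub> (commutator G x a) = commutator G a x" "commutator G x a \<in> carrier G"
        using commutator_inverse[OF True a] a by (auto simp: commutator_def)
      with True show ?thesis
        using a by (simp add: X_def Y_def \<phi>_def) (simp add: commutator_def mult)
    qed (use carr BA in \<open>simp add: X_def Y_def \<phi>_def\<close>)
    have "has_entries_in R n (\<lambda>x. X (\<phi> x))" "has_entries_in R n (\<lambda>x. Y (\<phi> x))"
      unfolding X\<phi> Y\<phi> by (intro has_entries_in_mult[OF Rs] X Y AB)+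
    then have "const_functions \<union> (entries X \<union> entries Y) \<subseteq> {q. q \<circ> \<phi> \<in> R}"
      using gens by (auto simp: has_entries_in_def entries_def const_functions_def o_def)
    moreover have "unital_subring {q. q \<circ> \<phi> \<in> R}"
    proof -
      have "(1 :: 'g \<Rightarrow> 'f) \<circ> \<phi> = 1" "(q - r) \<circ> \<phi> = (q \<circ> \<phi>) - (r \<circ> \<phi>)" "(q * r) \<circ> \<phi> = (q \<circ> \<phi>) * (r \<circ> \<phi>)"
        for q r :: "'g \<Rightarrow> 'f"
        by (auto simp: fun_eq_iff)
      then show ?thesis
        by (auto simp: unital_subring_def unital_subring_closed[OF Rs])
    qed
    ultimately have "p \<circ> \<phi> \<in> R"
      using least p by blast
    then show "\<exists>q\<in>R. \<forall>x\<in>carrier G. q x = p (commutator G x a)"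
      by (rule bexI[rotated]) (simp add: \<phi>_def)
  qed
qed

end
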